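(* Let $G$ be a trivially well-dominated graph. For any well-dominated graph $H$, the strong product $G\boxtimes H$ is well-dominated.
   Context: All graphs are finite and simple. $N_G(v)$ denotes the set of neighbors of $v$ in $G$, and $N_G[v]=N_G(v)\cup\{v\}$ is the closed neighborhood. A vertex subset $D$ of a graph $G$ is a dominating set if every vertex not in $D$ has a neighbor in $D$. A dominating set is minimal if no proper subset of it is a dominating set, and minimum if it has the smallest cardinality among all dominating sets. A graph is well-dominated if all its minimal dominating sets are minimum. A graph $G$ is trivially well-dominated if there is a set of vertices $v_1,v_2,\ldots,v_t$ such that their closed neighborhoods form a clique partition of $V(G)$; i.e., each closed neighborhood $N_G[v_i]$ is a clique and every vertex of $G$ is in precisely one of $N_G[v_1],\ldots,N_G[v_t]$. The strong product $G\boxtimes H$ has vertex set $V(G)\times V(H)$, and two distinct vertices $(u_1,v_1)$ and $(u_2,v_2)$ are adjacent if and only if $u_2\in N_G[u_1]$ and $v_2\in N_H[v_1]$. *)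

theory Defs
  imports "Graph_Theory.Pair_Digraph"
begin

text \<open>
  Finite simple graphs are the pair digraphs satisfying the predicate
  \<^const>\<open>pair_graph\<close>: a finite vertex set together with a symmetric irreflexive
  edge relation on it, so an undirected edge is stored as its two arcs.
  The definitions below apply to the underlying record and are meant for
  graphs with this property.
\<close>

definition nbhd :: "'a pair_pre_digraph \<Rightarrow> 'a \<Rightarrow> 'a set" where
  "nbhd G v = {u. (v, u) \<in> parcs G}"

definition closed_nbhd :: "'a pair_pre_digraph \<Rightarrow> 'a \<Rightarrow> 'a set" where
  "closed_nbhd G v = insert v (nbhd G v)"

definition is_clique :: "'a pair_pre_digraph \<Rightarrow> 'a set \<Rightarrow> bool" where
  "is_clique G C \<longleftrightarrow> C \<subseteq> pverts G \<and> (\<forall>u\<in>C. \<forall>v\<in>C. u \<noteq> v \<longrightarrow> (u, v) \<in> parcs G)"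

definition dominating_set :: "'a pair_pre_digraph \<Rightarrow> 'a set \<Rightarrow> bool" where
  "dominating_set G D \<longleftrightarrow> D \<subseteq> pverts G \<and> (\<forall>v\<in>pverts G - D. \<exists>u\<in>D. u \<in> nbhd G v)"

definition minimal_dominating_set :: "'a pair_pre_digraph \<Rightarrow> 'a set \<Rightarrow> bool" where
  "minimal_dominating_set G D \<longleftrightarrow>
     dominating_set G D \<and> (\<forall>D'. D' \<subset> D \<longrightarrow> \<not> dominating_set G D')"

definition minimum_dominating_set :: "'a pair_pre_digraph \<Rightarrow> 'a set \<Rightarrow> bool" where
  "minimum_dominating_set G D \<longleftrightarrow>
     dominating_set G D \<and> (\<forall>D'. dominating_set G D' \<longrightarrow> card D \<le> card D')"

definition well_dominated :: "'a pair_pre_digraph \<Rightarrow> bool" where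
  "well_dominated G \<longleftrightarrow> (\<forall>D. minimal_dominating_set G D \<longrightarrow> minimum_dominating_set G D)"

definition trivially_well_dominated :: "'a pair_pre_digraph \<Rightarrow> bool" where
  "trivially_well_dominated G \<longleftrightarrow>
     (\<exists>S\<subseteq>pverts G.
        (\<forall>v\<in>S. is_clique G (closed_nbhd G v)) \<and>
        (\<forall>u\<in>pverts G. \<exists>!v. v \<in> S \<and> u \<in> closed_nbhd G v))"

definition strong_product ::
  "'a pair_pre_digraph \<Rightarrow> 'b pair_pre_digraph \<Rightarrow> ('a \<times> 'b) pair_pre_digraph"
  (infixl \<open>\<boxtimes>\<close> 70) where
  "G \<boxtimes> H = \<lparr> pverts = pverts G \<times> pverts H,
     parcs = {((u1, v1), (u2, v2)) | u1 v1 u2 v2.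
       (u1, v1) \<in> pverts G \<times> pverts H \<and> (u2, v2) \<in> pverts G \<times> pverts H \<and>
       (u1, v1) \<noteq> (u2, v2) \<and> u2 \<in> closed_nbhd G u1 \<and> v2 \<in> closed_nbhd H v1} \<rparr>"

lemma pair_graph_strong_product:
  assumes "pair_graph G" and "pair_graph H"
  shows "pair_graph (G \<boxtimes> H)"
proof -
  interpret G: pair_graph G by fact
  interpret H: pair_graph H by fact
  have sub: "parcs (G \<boxtimes> H) \<subseteq> (pverts G \<times> pverts H) \<times> (pverts G \<times> pverts H)"
    by (auto simp: strong_product_def)
  have "finite (parcs (G \<boxtimes> H))"
    by (rule finite_subset[OF sub]) (simp add: G.pair_finite_verts H.pair_finite_verts)
  moreover have "sym (parcs (G \<boxtimes> H))"
    by (rule symI)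
      (auto simp: strong_product_def closed_nbhd_def nbhd_def
        intro: G.arcs_symmetric H.arcs_symmetric)
  ultimately show ?thesis
    by unfold_locales
      (auto simp: strong_product_def symmetric_def G.pair_finite_verts H.pair_finite_verts)
qed

end

theory Submission
  imports Defs
begin

text \<open>
  Let the closed neighbourhoods of the vertices \<open>s \<in> S\<close> partition \<open>G\<close> into cliques.
  They cut the product into layers \<open>N[s] \<times> V(H)\<close>, and so they cut every set \<open>D\<close> of
  product vertices into slices, one for each \<open>s\<close>. The point is that the layers do not
  interact.

  The slice of a dominating set projects onto a dominating set of \<open>H\<close>, because \<open>(s, y)\<close>
  can be dominated only from within the layer of \<open>s\<close> (\<open>dominating_set_slice\<close>).

  If \<open>D\<close> is minimal, each of its vertices has a private neighbour. This private neighbour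
  lies in the same layer: a vertex \<open>(x, y)\<close> of the layer of \<open>s\<close> has all the neighbours
  that \<open>(s, y)\<close> has, so whatever dominates \<open>(s, y)\<close> also dominates \<open>(x, y)\<close>, and it belongs
  to the layer of \<open>s\<close>. The second coordinate of the private neighbour is then private for
  the projected slice, and the projection is injective on the slice
  (\<open>slice_private_neighbour\<close>). Hence each slice projects bijectively onto a minimal
  dominating set of \<open>H\<close>, which is minimum because \<open>H\<close> is well-dominated. Slice by slice,
  no dominating set can be smaller than \<open>D\<close>.
\<close>

lemma dominating_set_iff_closed_nbhd:
  "dominating_set G D \<longleftrightarrow>
     D \<subseteq> pverts G \<and> (\<forall>v\<in>pverts G. \<exists>u\<in>D. u \<in> closed_nbhd G v)"
  unfolding dominating_set_def closed_nbhd_def by blast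

text \<open>
  Minimality becomes local in this form: a vertex of \<open>D\<close> is indispensable exactly when it
  is the sole dominator of some vertex.
\<close>

lemma minimal_dominating_set_iff_private_neighbour:
  "minimal_dominating_set G D \<longleftrightarrow>
     dominating_set G D \<and> (\<forall>d\<in>D. \<exists>x\<in>pverts G. closed_nbhd G x \<inter> D = {d})"
proof (intro iffI conjI ballI)
  assume "minimal_dominating_set G D"
  then show dom: "dominating_set G D"
    by (simp add: minimal_dominating_set_def)
  fix d assume "d \<in> D"
  then have "\<not> dominating_set G (D - {d})"
    using \<open>minimal_dominating_set G D\<close> unfolding minimal_dominating_set_def by blast
  then obtain x where x: "x \<in> pverts G" "closed_nbhd G x \<inter> (D - {d}) = {}"
    using dom unfolding dominating_set_iff_closed_nbhd by blast
  moreover have "closed_nbhd G x \<inter> D \<noteq> {}"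
    using dom x(1) unfolding dominating_set_iff_closed_nbhd by blast
  ultimately show "\<exists>x\<in>pverts G. closed_nbhd G x \<inter> D = {d}"
    by blast
next
  assume D: "dominating_set G D \<and> (\<forall>d\<in>D. \<exists>x\<in>pverts G. closed_nbhd G x \<inter> D = {d})"
  have "\<not> dominating_set G D'" if "D' \<subset> D" for D'
  proof -
    from that obtain d where d: "d \<in> D" "d \<notin> D'"
      by blast
    with D obtain x where "x \<in> pverts G" "closed_nbhd G x \<inter> D = {d}"
      by blast
    with d \<open>D' \<subset> D\<close> have "closed_nbhd G x \<inter> D' = {}"
      by auto
    with \<open>x \<in> pverts G\<close> show ?thesis
      unfolding dominating_set_iff_closed_nbhd by blast
  qed
  with D show "minimal_dominating_set G D"
    by (simp add: minimal_dominating_set_def)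
qed

lemma closed_nbhd_clique_subset:
  assumes "is_clique G (closed_nbhd G s)" and "x \<in> closed_nbhd G s"
  shows "closed_nbhd G s \<subseteq> closed_nbhd G x"
proof
  fix w assume "w \<in> closed_nbhd G s"
  then have "w = x \<or> (x, w) \<in> parcs G"
    using assms by (auto simp: is_clique_def)
  then show "w \<in> closed_nbhd G x"
    by (auto simp: closed_nbhd_def nbhd_def)
qed

lemma closed_nbhd_subset_pverts:
  assumes "pair_graph G" and "v \<in> pverts G"
  shows "closed_nbhd G v \<subseteq> pverts G"
proof -
  interpret pair_graph G by fact
  show ?thesis
    using assms(2) by (auto simp: closed_nbhd_def nbhd_def dest: in_arcsD2)
qed

lemma closed_nbhd_strong_product:
  assumes "pair_graph G" and "pair_graph H" and "x \<in> pverts G" and "y \<in> pverts H"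
  shows "closed_nbhd (G \<boxtimes> H) (x, y) = closed_nbhd G x \<times> closed_nbhd H y"
proof -
  have self: "x \<in> closed_nbhd G x" "y \<in> closed_nbhd H y"
    by (simp_all add: closed_nbhd_def)
  have "(u, v) \<in> closed_nbhd (G \<boxtimes> H) (x, y) \<longleftrightarrow>
      (u, v) = (x, y) \<or>
      u \<in> pverts G \<and> v \<in> pverts H \<and> u \<in> closed_nbhd G x \<and> v \<in> closed_nbhd H y"
    for u v
    using assms(3,4)
    by (auto simp: strong_product_def closed_nbhd_def[of "\<lparr>pverts = _, parcs = _\<rparr>"] nbhd_def)
  with self show ?thesis
    using closed_nbhd_subset_pverts[OF assms(1,3)] closed_nbhd_subset_pverts[OF assms(2,4)]
    by auto
qed

lemma pverts_strong_product: "pverts (G \<boxtimes> H) = pverts G \<times> pverts H"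
  by (simp add: strong_product_def)

definition slice :: "'a pair_pre_digraph \<Rightarrow> ('a \<times> 'b) set \<Rightarrow> 'a \<Rightarrow> ('a \<times> 'b) set" where
  "slice G D s = {p \<in> D. fst p \<in> closed_nbhd G s}"

lemma dominating_set_slice:
  assumes "pair_graph G" and "pair_graph H"
    and dom: "dominating_set (G \<boxtimes> H) D" and "s \<in> pverts G"
  shows "dominating_set H (snd ` slice G D s)"
  unfolding dominating_set_iff_closed_nbhd
proof (intro conjI ballI)
  show "snd ` slice G D s \<subseteq> pverts H"
    using dom by (auto simp: dominating_set_def pverts_strong_product slice_def)
  fix y assume "y \<in> pverts H"
  then have "\<exists>p\<in>D. p \<in> closed_nbhd G s \<times> closed_nbhd H y"
    using dom \<open>s \<in> pverts G\<close> closed_nbhd_strong_product[OF assms(1,2,4), of y]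
    unfolding dominating_set_iff_closed_nbhd pverts_strong_product by blast
  then show "\<exists>h\<in>snd ` slice G D s. h \<in> closed_nbhd H y"
    unfolding slice_def by force
qed

text \<open>
  Let \<open>(x, y)\<close> be a private neighbour of \<open>d\<close> in the product. Once \<open>x \<in> N[s]\<close> is known,
  every \<open>e\<close> in the slice with \<open>snd e \<in> N[y]\<close> dominates \<open>(x, y)\<close>, because \<open>N[s]\<close> is a
  clique; hence \<open>e = d\<close>. That the equation holds for \<open>e\<close> itself, and not only for its
  projection, makes the lemma serve twice: \<open>snd d\<close> has the private neighbour \<open>y\<close> in the
  projected slice, and no other vertex of the slice projects to \<open>snd d\<close>.
\<close>

lemma slice_private_neighbour:
  assumes "pair_graph G" and "pair_graph H"
    and S: "S \<subseteq> pverts G" "\<forall>v\<in>S. is_clique G (closed_nbhd G v)"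
      "\<forall>u\<in>pverts G. \<exists>!v. v \<in> S \<and> u \<in> closed_nbhd G v"
    and D: "minimal_dominating_set (G \<boxtimes> H) D"
    and "s \<in> S" and d: "d \<in> slice G D s"
  shows "\<exists>y\<in>pverts H. snd d \<in> closed_nbhd H y \<and>
    (\<forall>e\<in>slice G D s. snd e \<in> closed_nbhd H y \<longrightarrow> e = d)"
proof -
  note prod = closed_nbhd_strong_product[OF assms(1,2)]
  have dom: "dominating_set (G \<boxtimes> H) D"
    using D by (simp add: minimal_dominating_set_def)
  have "d \<in> D"
    using d by (simp add: slice_def)
  then obtain x y where x: "x \<in> pverts G" and y: "y \<in> pverts H"
    and "closed_nbhd (G \<boxtimes> H) (x, y) \<inter> D = {d}"
    using D unfolding minimal_dominating_set_iff_private_neighbour pverts_strong_product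
    by blast
  then have priv: "(closed_nbhd G x \<times> closed_nbhd H y) \<inter> D = {d}"
    by (simp add: prod)
  obtain t where t: "t \<in> S" "x \<in> closed_nbhd G t"
    using S(3) x by blast
  have sub: "closed_nbhd G t \<subseteq> closed_nbhd G x"
    using S(2) t by (intro closed_nbhd_clique_subset) simp_all
  \<comment> \<open>A dominator of \<open>(t, y)\<close> dominates \<open>(x, y)\<close> as well, so it must be \<open>d\<close>.\<close>
  have "dominating_set H (snd ` slice G D t)"
    using dominating_set_slice[OF assms(1,2) dom] S(1) t(1) by blast
  then obtain e where e: "e \<in> slice G D t" "snd e \<in> closed_nbhd H y"
    using y unfolding dominating_set_iff_closed_nbhd by blast
  have collapse: "e = d" if "e \<in> slice G D t" "snd e \<in> closed_nbhd H y" for e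
  proof -
    have "e \<in> (closed_nbhd G x \<times> closed_nbhd H y) \<inter> D"
      using that sub by (auto simp: slice_def mem_Times_iff)
    then show ?thesis
      using priv by blast
  qed
  have "d \<in> slice G D t"
    using collapse[OF e] e(1) by simp
  moreover have "fst d \<in> pverts G"
    using d dom by (auto simp: slice_def dominating_set_def pverts_strong_product)
  ultimately have "t = s"
    using S(3) d t(1) \<open>s \<in> S\<close> unfolding slice_def by blast
  show ?thesis
  proof (intro bexI[OF _ y] conjI ballI impI)
    show "snd d \<in> closed_nbhd H y"
      using priv by (metis Int_iff insertI1 mem_Times_iff)
    show "e = d" if "e \<in> slice G D s" "snd e \<in> closed_nbhd H y" for e
      using collapse that \<open>t = s\<close> by blast
  qed
qed

lemma slice_of_minimal_dominating_set:
  assumes "pair_graph G" and "pair_graph H"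
    and S: "S \<subseteq> pverts G" "\<forall>v\<in>S. is_clique G (closed_nbhd G v)"
      "\<forall>u\<in>pverts G. \<exists>!v. v \<in> S \<and> u \<in> closed_nbhd G v"
    and D: "minimal_dominating_set (G \<boxtimes> H) D" and "s \<in> S"
  shows "inj_on snd (slice G D s)" and "minimal_dominating_set H (snd ` slice G D s)"
proof -
  note private_neighbour = slice_private_neighbour[OF assms]
  show "inj_on snd (slice G D s)"
  proof (rule inj_onI)
    fix d e assume "d \<in> slice G D s" "e \<in> slice G D s" "snd d = snd e"
    then show "d = e"
      using private_neighbour[of d] by metis
  qed
  have "dominating_set H (snd ` slice G D s)"
    using dominating_set_slice[OF assms(1,2)] D S(1) \<open>s \<in> S\<close>
    unfolding minimal_dominating_set_def by blast
  moreover have "\<exists>y\<in>pverts H. closed_nbhd H y \<inter> snd ` slice G D s = {snd d}"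
    if d: "d \<in> slice G D s" for d
  proof -
    obtain y where "y \<in> pverts H" "snd d \<in> closed_nbhd H y"
      "\<forall>e\<in>slice G D s. snd e \<in> closed_nbhd H y \<longrightarrow> e = d"
      using private_neighbour[OF d] by blast
    then have "closed_nbhd H y \<inter> snd ` slice G D s = {snd d}"
      using d by blast
    then show ?thesis
      using \<open>y \<in> pverts H\<close> by blast
  qed
  ultimately show "minimal_dominating_set H (snd ` slice G D s)"
    by (simp add: minimal_dominating_set_iff_private_neighbour)
qed

lemma card_eq_sum_slices:
  assumes "finite (pverts G)" and "S \<subseteq> pverts G"
    and "\<forall>u\<in>pverts G. \<exists>!v. v \<in> S \<and> u \<in> closed_nbhd G v"
    and "finite D" and "fst ` D \<subseteq> pverts G"
  shows "card D = (\<Sum>s\<in>S. card (slice G D s))"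
proof -
  have "\<exists>s\<in>S. p \<in> slice G D s" if "p \<in> D" for p
  proof -
    have "fst p \<in> pverts G"
      using that assms(5) by blast
    then show ?thesis
      using that assms(3) unfolding slice_def by blast
  qed
  then have "D = (\<Union>s\<in>S. slice G D s)"
    by (auto simp: slice_def)
  moreover have "card (\<Union>s\<in>S. slice G D s) = (\<Sum>s\<in>S. card (slice G D s))"
  proof (rule card_UN_disjoint)
    show "finite S"
      using assms(1,2) by (rule rev_finite_subset)
    show "\<forall>s\<in>S. finite (slice G D s)"
      using assms(4) by (simp add: slice_def)
    show "\<forall>s\<in>S. \<forall>t\<in>S. s \<noteq> t \<longrightarrow> slice G D s \<inter> slice G D t = {}"
    proof (intro ballI impI equals0I)
      fix s t p assume "s \<in> S" "t \<in> S" "s \<noteq> t" and p: "p \<in> slice G D s \<inter> slice G D t"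
      have "fst p \<in> pverts G"
        using p assms(5) unfolding slice_def by blast
      then show False
        using p assms(3) \<open>s \<in> S\<close> \<open>t \<in> S\<close> \<open>s \<noteq> t\<close> unfolding slice_def by blast
    qed
  qed
  ultimately show ?thesis
    by simp
qed

theorem theorem1p1:
  fixes G :: "'a pair_pre_digraph" and H :: "'b pair_pre_digraph"
  assumes "pair_graph G" and "pair_graph H"
    and "trivially_well_dominated G"
    and "well_dominated H"
  shows "well_dominated (G \<boxtimes> H)"
  unfolding well_dominated_def minimum_dominating_set_def
proof (intro allI impI conjI)
  interpret G: pair_graph G by fact
  interpret H: pair_graph H by fact
  obtain S where S: "S \<subseteq> pverts G" "\<forall>v\<in>S. is_clique G (closed_nbhd G v)"
    "\<forall>u\<in>pverts G. \<exists>!v. v \<in> S \<and> u \<in> closed_nbhd G v"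
    using \<open>trivially_well_dominated G\<close> unfolding trivially_well_dominated_def by blast
  have finite: "finite E" and sum: "card E = (\<Sum>s\<in>S. card (slice G E s))"
    if "dominating_set (G \<boxtimes> H) E" for E
  proof -
    have sub: "E \<subseteq> pverts G \<times> pverts H"
      using that by (simp add: dominating_set_def pverts_strong_product)
    then show "finite E"
      by (rule finite_subset) simp
    then show "card E = (\<Sum>s\<in>S. card (slice G E s))"
      using sub by (intro card_eq_sum_slices[OF G.pair_finite_verts S(1,3)]) auto
  qed
  fix D assume D: "minimal_dominating_set (G \<boxtimes> H) D"
  then show dom: "dominating_set (G \<boxtimes> H) D"
    by (simp add: minimal_dominating_set_def)
  fix D' assume D': "dominating_set (G \<boxtimes> H) D'"
  have "card (slice G D s) \<le> card (slice G D' s)" if "s \<in> S" for s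
  proof -
    note min = slice_of_minimal_dominating_set[OF assms(1,2) S D that]
    have "dominating_set H (snd ` slice G D' s)"
      using dominating_set_slice[OF assms(1,2) D'] S(1) that by blast
    then have "card (snd ` slice G D s) \<le> card (snd ` slice G D' s)"
      using min(2) \<open>well_dominated H\<close>
      unfolding well_dominated_def minimum_dominating_set_def by blast
    also have "\<dots> \<le> card (slice G D' s)"
      using finite[OF D'] by (intro card_image_le) (simp add: slice_def)
    finally show ?thesis
      using card_image[OF min(1)] by simp
  qed
  then show "card D \<le> card D'"
    unfolding sum[OF dom] sum[OF D'] by (rule sum_mono)
qed

end
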